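(* Let $S = \{ n \in \mathbb{N} \mid \exists\, x,y,z \in \mathbb{N}_0 : n = x^2+y^2+z^2 \}$ be the set of positive integers that are sums of three squares of non-negative integers. Then the minimal set of $S$ is $$M(S) = \{ 1,2,3,4,5,6,8,9,70,77 \}.$$
   Context: $\mathbb{N}=\{1,2,3,\ldots\}$ denotes the positive integers and $\mathbb{N}_0=\mathbb{N}\cup\{0\}$. Each positive integer is identified with its usual base-10 digit string (without leading zeros). For positive integers $x,y$ write $x \triangleleft y$ if the digit string of $x$ is a subsequence (in order, not necessarily contiguous) of the digit string of $y$, i.e. either $x=y$ or $x$ is obtained from $y$ by deleting some digits of $y$ (for example $514 \triangleleft 352148$). For a set $S\subset\mathbb{N}$, the minimal set of $S$ is $$M(S) := \{ s\in S \mid \{ n\in S : n<s,\ n\triangleleft s\}=\varnothing \}.$$ *)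

theory Defs
  imports Main "HOL-Library.Sublist"
begin

(* Base-10 digits, most significant first; no leading zeros for positive arguments. *)
fun digits :: "nat \<Rightarrow> nat list" where
  "digits n = (if n < 10 then [n] else digits (n div 10) @ [n mod 10])"

declare digits.simps [simp del]

definition digit_subseq :: "nat \<Rightarrow> nat \<Rightarrow> bool"  (infix "\<triangleleft>" 50) where
  "x \<triangleleft> y \<longleftrightarrow> subseq (digits x) (digits y)"

definition minimal_set :: "nat set \<Rightarrow> nat set" where
  "minimal_set S = {s \<in> S. {n \<in> S. n < s \<and> n \<triangleleft> s} = {}}"

end

(* Only 0 and 7 are decimal digits of a number that contains none of 1, 2, 3, 4, 5, 6, 8, 9.
   Since the leading digit is not 0, such a number is 7 itself or it starts with 70 or 77;
   and 7 is not a sum of three squares. Hence no three-squares theorem is needed, and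
   looking at the two leading digits suffices. *)
theory Submission
  imports Defs
begin

lemma digits_less_10: "n < 10 \<Longrightarrow> digits n = [n]"
  by (subst digits.simps) simp

lemma digits_ge_10: "n \<ge> 10 \<Longrightarrow> digits n = digits (n div 10) @ [n mod 10]"
  by (subst digits.simps) simp

lemma digits_less_100: "10 \<le> n \<Longrightarrow> n < 100 \<Longrightarrow> digits n = [n div 10, n mod 10]"
  by (simp add: digits_ge_10 digits_less_10)

lemma digit_subseq_trans: "x \<triangleleft> y \<Longrightarrow> y \<triangleleft> z \<Longrightarrow> x \<triangleleft> z"
  unfolding digit_subseq_def by (rule subseq_order.order_trans)

text \<open>The witness is the number formed by the two leading digits: strong induction strips the
  last digit until two remain. This reduces all longer numbers to
  \<open>two_digits_contain\<close>.\<close>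

lemma two_leading_digits: "n \<ge> 10 \<Longrightarrow> \<exists>k. 10 \<le> k \<and> k < 100 \<and> k \<triangleleft> n"
proof (induction n rule: less_induct)
  case (less n)
  show ?case
  proof (cases "n < 100")
    case True
    then show ?thesis using less.prems by (auto simp: digit_subseq_def)
  next
    case False
    then have "n div 10 < n" "10 \<le> n div 10" by linarith+
    then obtain k where k: "10 \<le> k" "k < 100" "k \<triangleleft> n div 10"
      using less.IH[of "n div 10"] by blast
    have "n div 10 \<triangleleft> n"
      unfolding digit_subseq_def digits_ge_10[OF less.prems]
      by (rule subseq_rev_drop_many) simp
    with k show ?thesis by (blast intro: digit_subseq_trans)
  qed
qed

lemma digit_subseq_two_digits:
  assumes "10 \<le> n" "n < 100"
  shows "n div 10 \<triangleleft> n" "n mod 10 \<triangleleft> n"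
  using assms by (simp_all add: digit_subseq_def digits_less_100 digits_less_10)

text \<open>A number with at least two digits is too long to embed in a single digit, and two
  one-element lists embed only if they are equal.\<close>

lemma digit_subseq_less_10:
  assumes "m \<triangleleft> n" "n < 10"
  shows "m = n"
proof (cases "m < 10")
  case True
  with assms show ?thesis by (auto simp: digit_subseq_def digits_less_10 split: if_splits)
next
  case False
  have "length (digits m) \<ge> 2"
  proof -
    have "length (digits (m div 10)) \<ge> 1" by (subst digits.simps) simp
    with False show ?thesis by (simp add: digits_ge_10)
  qed
  moreover have "length (digits m) \<le> 1"
    using assms list_emb_length[of "(=)" "digits m" "digits n"]
    by (simp add: digit_subseq_def digits_less_10)
  ultimately show ?thesis by simp
qed

text \<open>A two-digit \<open>m\<close> would have the same length as \<open>n\<close>, hence equal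
  it, against \<open>m < n\<close>. The value \<open>m = 0\<close> can occur, since
  \<open>digits 0 = [0]\<close> embeds when the last digit of \<open>n\<close> is 0.\<close>

lemma digit_subseq_less_100:
  assumes "m \<triangleleft> n" "10 \<le> n" "n < 100" "m < n"
  shows "m = n div 10 \<or> m = n mod 10"
proof (cases "m < 10")
  case True
  with assms show ?thesis
    by (auto simp: digit_subseq_def digits_less_10 digits_less_100 split: if_splits)
next
  case False
  with assms have "digits m = digits n"
    by (intro subseq_same_length) (simp_all add: digit_subseq_def digits_less_100)
  with False assms have "m div 10 = n div 10" "m mod 10 = n mod 10"
    by (simp_all add: digits_less_100)
  with assms show ?thesis by (metis div_mult_mod_eq less_irrefl)
qed

lemma less_10_iff: "n < 10 \<longleftrightarrow> n \<in> {0, 1, 2, 3, 4, 5, 6, 7, 8, 9}" for n :: nat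
  by (auto simp: numeral_eq_Suc less_Suc_eq)

text \<open>If neither digit lies in \<open>?D\<close>, both are 0 or 7, and the leading one must be
  7. The bound \<open>m \<le> k\<close> is included because minimality only speaks of smaller
  elements.\<close>

lemma two_digits_contain:
  assumes "10 \<le> k" "k < 100"
  shows "\<exists>m\<in>{1, 2, 3, 4, 5, 6, 8, 9, 70, 77}. m \<triangleleft> k \<and> m \<le> k"
proof -
  let ?D = "{1, 2, 3, 4, 5, 6, 8, 9} :: nat set"
  consider "k div 10 \<in> ?D" | "k mod 10 \<in> ?D"
    | "k div 10 \<in> {0, 7}" "k mod 10 \<in> {0, 7}"
  proof -
    have "d \<in> ?D \<or> d \<in> {0, 7}" if "d < 10" for d
      using that unfolding less_10_iff by blast
    moreover have "k div 10 < 10" "k mod 10 < 10" using assms by auto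
    ultimately show ?thesis using that by blast
  qed
  then show ?thesis
  proof cases
    case 1
    with digit_subseq_two_digits(1)[OF assms] show ?thesis
      using div_le_dividend[of k 10] by blast
  next
    case 2
    with digit_subseq_two_digits(2)[OF assms] show ?thesis
      using mod_less_eq_dividend[of k 10] by blast
  next
    case 3
    with assms(1) have "k div 10 = 7" by auto
    then have "k = 7 * 10 + k mod 10" by (metis div_mult_mod_eq)
    with 3(2) have "k = 70 \<or> k = 77" by auto
    then show ?thesis by (auto simp: digit_subseq_def)
  qed
qed

text \<open>Since 3 squared exceeds 7, each base is at most 2, which leaves finitely many triples to
  check.\<close>

lemma seven_not_sum_three_squares: "(7::nat) \<noteq> x\<^sup>2 + y\<^sup>2 + z\<^sup>2"
proof
  assume eq: "7 = x\<^sup>2 + y\<^sup>2 + z\<^sup>2"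
  have "w \<in> {0, 1, 2}" if "w\<^sup>2 \<le> 7" for w :: nat
  proof -
    have "w < 3" using that by (intro power_less_imp_less_base[of w 2 3]) simp_all
    then show ?thesis by auto
  qed
  with eq have "x \<in> {0, 1, 2}" "y \<in> {0, 1, 2}" "z \<in> {0, 1, 2}" by simp_all
  with eq show False by auto
qed

theorem theorem1:
  "minimal_set {n :: nat. n > 0 \<and> (\<exists>x y z :: nat. n = x\<^sup>2 + y\<^sup>2 + z\<^sup>2)}
     = {1, 2, 3, 4, 5, 6, 8, 9, 70, 77}"
  (is "minimal_set ?S = ?M")
proof
  have M_S: "m \<in> ?S" if "m \<in> ?M" for m
  proof -
    have sq: "n \<in> ?S" if "n > 0" "n = x\<^sup>2 + y\<^sup>2 + z\<^sup>2" for n x y z :: nat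
      using that by blast
    have "1 \<in> ?S" "2 \<in> ?S" "3 \<in> ?S" "4 \<in> ?S" "5 \<in> ?S"
      "6 \<in> ?S" "8 \<in> ?S" "9 \<in> ?S" "70 \<in> ?S" "77 \<in> ?S"
      \<comment> \<open>The larger witnesses are 70 = 36 + 25 + 9 and 77 = 64 + 9 + 4. Backtracking
        over the instances of \<open>sq\<close> selects the one whose equation holds.\<close>
      by (rule sq[of _ 1 0 0] sq[of _ 1 1 0] sq[of _ 1 1 1] sq[of _ 2 0 0] sq[of _ 2 1 0]
          sq[of _ 2 1 1] sq[of _ 2 2 0] sq[of _ 3 0 0] sq[of _ 6 5 3] sq[of _ 8 3 2]; simp; fail)+
    with that show ?thesis
      by (elim insertE emptyE) (simp_all only:)
  qed
  have seven: "7 \<notin> ?S" using seven_not_sum_three_squares by blast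
  show "minimal_set ?S \<subseteq> ?M"
  proof
    fix n assume n: "n \<in> minimal_set ?S"
    then have "n \<in> ?S" by (simp add: minimal_set_def)
    have minimal: "\<not> m < n" if "m \<in> ?M" "m \<triangleleft> n" for m
      using n M_S[OF that(1)] that(2) unfolding minimal_set_def by blast
    consider "n < 10" | "10 \<le> n" "n < 100" | "100 \<le> n" by linarith
    then show "n \<in> ?M"
    proof cases
      case 1
      have "n \<noteq> 7" "n \<noteq> 0" using seven \<open>n \<in> ?S\<close> by blast+
      with 1 show ?thesis unfolding less_10_iff by blast
    next
      case 2
      then obtain m where "m \<in> ?M" "m \<triangleleft> n" "m \<le> n"
        using two_digits_contain by blast
      \<comment> \<open>Minimality rules out \<open>m < n\<close>, so \<open>n\<close> is the
        element \<open>m\<close> of \<open>?M\<close> itself.\<close>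
      with minimal show ?thesis using le_neq_implies_less by blast
    next
      case 3
      then obtain k where k: "10 \<le> k" "k < 100" "k \<triangleleft> n"
        using two_leading_digits[of n] by auto
      then obtain m where m: "m \<in> ?M" "m \<triangleleft> k" "m \<le> k"
        using two_digits_contain by blast
      \<comment> \<open>Here \<open>m \<le> k < 100 \<le> n\<close> makes \<open>m\<close> strictly
        smaller than \<open>n\<close>, so no minimal element has three or more digits.\<close>
      with minimal[OF m(1) digit_subseq_trans[OF m(2) k(3)]] k(2) 3
      show ?thesis by linarith
    qed
  qed
  show "?M \<subseteq> minimal_set ?S"
  proof
    fix s assume s: "s \<in> ?M"
    have "\<not> (m < s \<and> m \<triangleleft> s)" if "m \<in> ?S" for m
    proof
      assume m: "m < s \<and> m \<triangleleft> s"
      then have "\<not> s < 10" using digit_subseq_less_10 by blast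
      with s have "s = 70 \<or> s = 77" by auto
      \<comment> \<open>The only digits of 70 and 77 are 7 and 0; the first is not a sum of three
        squares and the second is not positive.\<close>
      then have "m = 7 \<or> m = 0" using m digit_subseq_less_100[of m s] by auto
      moreover have "m \<noteq> 7" "m \<noteq> 0" using that seven by blast+
      ultimately show False by blast
    qed
    with M_S[OF s] show "s \<in> minimal_set ?S"
      unfolding minimal_set_def by blast
  qed
qed

end
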